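(* Let $f:I\times\mathbb{R}\times\mathbb{R}\to\mathbb{R}$ be a function such that $f(\cdot,u(\cdot),{}_HD_{1^+}^{\alpha,\beta}u(\cdot))\in C_{1-\gamma,\log}[I,\mathbb{R}]$ for any $u\in C_{1-\gamma,\log}[I,\mathbb{R}]$. A function $u\in C_{1-\gamma,\log}^{\gamma}[I,\mathbb{R}]$ is a solution of the boundary value problem $${}_HD_{1^+}^{\alpha,\beta}u(t)=f\big(t,u(t),{}_HD_{1^+}^{\alpha,\beta}u(t)\big),\ t\in I,\qquad {}_HI_{1^+}^{1-\gamma}\big[c_1u(1^+)+c_2u(b^-)\big]=\phi$$ if and only if $u$ satisfies the mixed-type integral equation $$u(t)=\frac{\phi}{c_1+c_2}\frac{(\log t)^{\gamma-1}}{\Gamma(\gamma)}-\frac{c_2}{c_1+c_2}\frac{(\log t)^{\gamma-1}}{\Gamma(\gamma)}\frac{1}{\Gamma(1-\gamma+\alpha)}\int_1^b\Big(\log\frac bs\Big)^{\alpha-\gamma}\mathcal{F}_u(s)\frac{ds}{s}+\frac1{\Gamma(\alpha)}\int_1^t\Big(\log\frac ts\Big)^{\alpha-1}\mathcal{F}_u(s)\frac{ds}{s},$$ where $\mathcal{F}_u(t):=f(t,u(t),\mathcal{F}_u(t))={}_HD_{1^+}^{\alpha,\beta}u(t)$.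
   Context: Standing assumptions: $b>1$, $I=[1,b]$, $0<\alpha<1$, $0\le\beta\le1$, $\gamma=\alpha+\beta-\alpha\beta$ (so $\alpha\le\gamma$) with $\gamma<1$; $c_1,c_2,\phi\in\mathbb{R}$ with $c_1+c_2\ne0$, $c_2\ne0$; $\log=\log_e$. Weighted space: $C_{1-\gamma,\log}[I,\mathbb{R}]$ is the set of $\varphi:(1,b]\to\mathbb{R}$ such that $(\log t)^{1-\gamma}\varphi(t)$ is (extends to) a continuous function on $I$, with norm $\|\varphi\|_{C_{1-\gamma,\log}}=\sup_{t\in I}|(\log t)^{1-\gamma}\varphi(t)|$. Hadamard fractional integral of order $a>0$: $({}_HI_{1^+}^{a}\varphi)(t)=\frac1{\Gamma(a)}\int_1^t(\log\frac ts)^{a-1}\varphi(s)\frac{ds}s$; ${}_HI_{1^+}^0$ is the identity. Hadamard derivative of order $a\in(0,1)$: ${}_HD_{1^+}^{a}=\big(t\frac{d}{dt}\big){}_HI_{1^+}^{1-a}$. Hilfer-Hadamard derivative of order $\alpha$ and type $\beta$: ${}_HD_{1^+}^{\alpha,\beta}={}_HI_{1^+}^{\beta(1-\alpha)}\,\big(t\frac d{dt}\big)\,{}_HI_{1^+}^{(1-\beta)(1-\alpha)}={}_HI_{1^+}^{\beta(1-\alpha)}\,{}_HD_{1^+}^{\gamma}$. $C^{\gamma}_{1-\gamma,\log}[I,\mathbb{R}]=\{u\in C_{1-\gamma,\log}[I,\mathbb{R}]:{}_HD_{1^+}^{\gamma}u\in C_{1-\gamma,\log}[I,\mathbb{R}]\}$.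 The boundary condition ${}_HI_{1^+}^{1-\gamma}[c_1u(1^+)+c_2u(b^-)]=\phi$ means $c_1\lim_{t\to1^+}({}_HI_{1^+}^{1-\gamma}u)(t)+c_2\lim_{t\to b^-}({}_HI_{1^+}^{1-\gamma}u)(t)=\phi$. Equations "for $t\in I$" between functions in weighted spaces are understood on $(1,b]$. *)

theory Defs
  imports "HOL-Analysis.Analysis"
begin

text \<open>
  Functions on the half-open interval from \<open>1\<close> (exclusive) to \<open>b\<close> (inclusive) are represented by
  total functions of type \<open>real \<Rightarrow> real\<close>; values elsewhere are irrelevant, as
  all integrals, derivatives and equations below only involve points of this interval.
\<close>

definition weighted_C :: "real \<Rightarrow> real \<Rightarrow> (real \<Rightarrow> real) set" where
  "weighted_C b \<gamma> =
    {\<phi>. \<exists>g. continuous_on {1..b} g \<and> (\<forall>t\<in>{1<..b}. g t = ln t powr (1 - \<gamma>) * \<phi> t)}"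

definition hadamard_integrable :: "real \<Rightarrow> (real \<Rightarrow> real) \<Rightarrow> real \<Rightarrow> bool" where
  "hadamard_integrable a \<phi> t \<longleftrightarrow>
    a = 0 \<or> set_integrable lborel {1<..t} (\<lambda>s. ln (t / s) powr (a - 1) * \<phi> s / s)"

definition hadamard_integral :: "real \<Rightarrow> (real \<Rightarrow> real) \<Rightarrow> real \<Rightarrow> real" where
  "hadamard_integral a \<phi> t =
    (if a = 0 then \<phi> t
     else 1 / Gamma a * (LBINT s:{1<..t}. ln (t / s) powr (a - 1) * \<phi> s / s))"

text \<open>The operator \<open>t d/dt\<close>; at the right endpoint \<open>b\<close> the derivative is one-sided.\<close>

definition log_deriv :: "real \<Rightarrow> (real \<Rightarrow> real) \<Rightarrow> real \<Rightarrow> real" where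
  "log_deriv b \<phi> t = t * vector_derivative \<phi> (at t within {1<..b})"

definition hadamard_derivative :: "real \<Rightarrow> real \<Rightarrow> (real \<Rightarrow> real) \<Rightarrow> real \<Rightarrow> real" where
  "hadamard_derivative b a \<phi> = log_deriv b (hadamard_integral (1 - a) \<phi>)"

definition hadamard_derivative_exists :: "real \<Rightarrow> real \<Rightarrow> (real \<Rightarrow> real) \<Rightarrow> bool" where
  "hadamard_derivative_exists b a \<phi> \<longleftrightarrow>
    (\<forall>t\<in>{1<..b}. hadamard_integrable (1 - a) \<phi> t) \<and>
    hadamard_integral (1 - a) \<phi> differentiable_on {1<..b}"

definition hilfer_hadamard :: "real \<Rightarrow> real \<Rightarrow> real \<Rightarrow> (real \<Rightarrow> real) \<Rightarrow> real \<Rightarrow> real" where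
  "hilfer_hadamard b \<alpha> \<beta> \<phi> =
    hadamard_integral (\<beta> * (1 - \<alpha>))
      (log_deriv b (hadamard_integral ((1 - \<beta>) * (1 - \<alpha>)) \<phi>))"

text \<open>All integrals and derivatives occurring in \<open>hilfer_hadamard b \<alpha> \<beta> \<phi>\<close> exist, so that its
  value is not an artefact of totality.\<close>

definition hilfer_hadamard_exists :: "real \<Rightarrow> real \<Rightarrow> real \<Rightarrow> (real \<Rightarrow> real) \<Rightarrow> bool" where
  "hilfer_hadamard_exists b \<alpha> \<beta> \<phi> \<longleftrightarrow>
    (\<forall>t\<in>{1<..b}. hadamard_integrable ((1 - \<beta>) * (1 - \<alpha>)) \<phi> t) \<and>
    hadamard_integral ((1 - \<beta>) * (1 - \<alpha>)) \<phi> differentiable_on {1<..b} \<and>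
    (\<forall>t\<in>{1<..b}. hadamard_integrable (\<beta> * (1 - \<alpha>))
       (log_deriv b (hadamard_integral ((1 - \<beta>) * (1 - \<alpha>)) \<phi>)) t)"

definition weighted_C_deriv :: "real \<Rightarrow> real \<Rightarrow> (real \<Rightarrow> real) set" where
  "weighted_C_deriv b \<gamma> =
    {u \<in> weighted_C b \<gamma>. hadamard_derivative_exists b \<gamma> u \<and> hadamard_derivative b \<gamma> u \<in> weighted_C b \<gamma>}"

definition boundary_condition ::
  "real \<Rightarrow> real \<Rightarrow> real \<Rightarrow> real \<Rightarrow> real \<Rightarrow> (real \<Rightarrow> real) \<Rightarrow> bool" where
  "boundary_condition b \<gamma> c\<^sub>1 c\<^sub>2 \<phi> u \<longleftrightarrow>
    (\<exists>L\<^sub>1 L\<^sub>2. (hadamard_integral (1 - \<gamma>) u \<longlongrightarrow> L\<^sub>1) (at_right 1) \<and>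
            (hadamard_integral (1 - \<gamma>) u \<longlongrightarrow> L\<^sub>2) (at_left b) \<and>
            c\<^sub>1 * L\<^sub>1 + c\<^sub>2 * L\<^sub>2 = \<phi>)"

definition integral_equation ::
  "real \<Rightarrow> real \<Rightarrow> real \<Rightarrow> real \<Rightarrow> real \<Rightarrow> real \<Rightarrow> (real \<Rightarrow> real) \<Rightarrow> (real \<Rightarrow> real) \<Rightarrow> bool" where
  "integral_equation b \<alpha> \<gamma> c\<^sub>1 c\<^sub>2 \<phi> F u \<longleftrightarrow>
    (\<forall>t\<in>{1<..b}. u t =
        \<phi> / (c\<^sub>1 + c\<^sub>2) * (ln t powr (\<gamma> - 1) / Gamma \<gamma>)
      - c\<^sub>2 / (c\<^sub>1 + c\<^sub>2) * (ln t powr (\<gamma> - 1) / Gamma \<gamma>) * (1 / Gamma (1 - \<gamma> + \<alpha>))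
          * (LBINT s:{1<..b}. ln (b / s) powr (\<alpha> - \<gamma>) * F s / s)
      + 1 / Gamma \<alpha> * (LBINT s:{1<..t}. ln (t / s) powr (\<alpha> - 1) * F s / s))"

text \<open>\<open>F\<close> is an admissible choice of the function \<open>F\<^sub>u\<close> given implicitly by
  \<open>F\<^sub>u(t) = f(t, u(t), F\<^sub>u(t))\<close>. This does not mention the derivative of \<open>u\<close>. Membership in the
  weighted space makes the integrals of \<open>F\<close> converge and excludes changing \<open>F\<close> on a null set.\<close>

definition implicit_rhs ::
  "real \<Rightarrow> real \<Rightarrow> (real \<Rightarrow> real \<Rightarrow> real \<Rightarrow> real) \<Rightarrow> (real \<Rightarrow> real) \<Rightarrow> (real \<Rightarrow> real) \<Rightarrow> bool" where
  "implicit_rhs b \<gamma> f u F \<longleftrightarrow> F \<in> weighted_C b \<gamma> \<and> (\<forall>t\<in>{1<..b}. F t = f t (u t) (F t))"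

end

theory Submission
  imports Defs
begin

text \<open>
  The Hadamard kernels satisfy the Chapman--Kolmogorov identity (a Beta integral), so Fubini gives
  the semigroup law \<open>I\<^sup>a I\<^sup>c = I\<^bsup>a+c\<^esup>\<close> on the weighted space. The substitution \<open>s = t\<^sup>x\<close>
  shows that \<open>I\<^sup>a \<phi>\<close> is \<open>(log t)\<^bsup>a+\<gamma>-1\<^esup>\<close> times a continuous function on the closed interval.
  Hence \<open>I\<^sup>a\<close> preserves the weighted space, and it is injective there for \<open>a \<le> 1\<close>, because \<open>I\<^sup>1\<close> can
  be differentiated. With \<open>w = D\<^sup>\<gamma> u\<close> the fundamental theorem of calculus gives
  \<open>I\<^bsup>1-\<gamma>\<^esup> u = L + I\<^sup>1 w\<close>, and injectivity turns this into
  \<open>u = L (log t)\<^bsup>\<gamma>-1\<^esup> / \<Gamma>(\<gamma>) + I\<^sup>\<gamma> w\<close>. Here \<open>I\<^sup>\<gamma> w = I\<^sup>\<alpha> G\<close> for the Hilfer--Hadamard derivative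
  \<open>G = I\<^bsup>\<gamma>-\<alpha>\<^esup> w\<close>, the pair \<open>(L, G)\<close> in such a representation is unique, and the boundary condition
  is a linear equation for \<open>L\<close>.
\<close>

section \<open>Hadamard kernels and their composition\<close>

text \<open>The normalisation by \<open>Gamma a\<close> and the measure \<open>ds / s\<close> are
  built into the kernel, and it is cut off to zero outside \<open>0 < s < t\<close>. Integrals can
  then run over all of \<open>lborel\<close>; the lower limit 1 is carried by an indicator on the
  integrated function.\<close>

definition hadamard_kernel :: "real \<Rightarrow> real \<Rightarrow> real \<Rightarrow> real" where
  "hadamard_kernel a t s = (if 0 < s \<and> s < t then ln (t / s) powr (a - 1) / (Gamma a * s) else 0)"

lemma hadamard_kernel_nonneg: "0 < a \<Longrightarrow> 0 \<le> hadamard_kernel a t s"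
  by (simp add: hadamard_kernel_def Gamma_real_pos less_imp_le)

lemma measurable_hadamard_kernel [measurable]:
  assumes [measurable]: "f \<in> borel_measurable M" "g \<in> borel_measurable M"
  shows "(\<lambda>x. hadamard_kernel a (f x) (g x)) \<in> borel_measurable M"
  unfolding hadamard_kernel_def by measurable

lemma nn_integral_Beta:
  fixes a c :: real
  assumes "0 < a" "0 < c"
  shows "(\<integral>\<^sup>+x. ennreal (x powr (a - 1) * (1 - x) powr (c - 1)) * indicator {0..1} x \<partial>lborel)
    = ennreal (Beta a c)"
  by (rule nn_integral_has_integral_lebesgue'[OF _ has_integral_Beta_real[OF assms]]) auto

text \<open>With \<open>l = ln (t / r)\<close>, the substitution \<open>s = r * exp (x * l)\<close>
  maps [0,1] onto [r,t] and turns the two logarithms into \<open>l * (1 - x)\<close> and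
  \<open>l * x\<close>. What remains is a Beta integral, whose Gamma factors cancel the
  normalisations. The nonnegative integral makes the identity usable before any integrability is
  known.\<close>

lemma hadamard_kernel_chapman_kolmogorov:
  assumes a: "0 < a" and c: "0 < c" and r: "0 < r"
  shows "(\<integral>\<^sup>+s. ennreal (hadamard_kernel a t s * hadamard_kernel c s r) \<partial>lborel)
    = ennreal (hadamard_kernel (a + c) t r)"
proof (cases "r < t")
  case False
  then have "hadamard_kernel a t s * hadamard_kernel c s r = 0" for s
    by (auto simp: hadamard_kernel_def)
  with False show ?thesis by (simp only:) (simp add: hadamard_kernel_def)
next
  case True
  define l where "l = ln (t / r)"
  have l: "0 < l" and t: "t = r * exp l" using True r by (auto simp: l_def)
  let ?f = "\<lambda>s. hadamard_kernel a t s * hadamard_kernel c s r"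
  let ?g = "\<lambda>x. r * exp (x * l)"
  let ?C = "l powr (a + c - 1) / (Gamma a * Gamma c * r)"
  \<comment> \<open>The Jacobian \<open>?g x * l\<close> supplies the missing power of
    \<open>l\<close> and cancels the factor 1/s of the outer kernel. At x = 0 and x = 1 both sides
    vanish, since the inequalities in the kernel are strict and \<open>0 powr p = 0\<close>.\<close>
  have f: "?f (?g x) * (?g x * l) = ?C * (x powr (c - 1) * (1 - x) powr (a - 1))" if "x \<in> {0..1}" for x
  proof (cases "x = 0 \<or> x = 1")
    case True
    then show ?thesis by (auto simp: hadamard_kernel_def t)
  next
    case False
    with that have x: "0 < x" "x < 1" by auto
    have 1: "ln (t / ?g x) = l * (1 - x)" using r
      by (simp add: t exp_diff[symmetric] algebra_simps)
    have 2: "ln (?g x / r) = l * x" using r by (simp add: mult_ac)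
    have 3: "l powr (a - 1) * l powr (c - 1) * l = l powr (a + c - 1)"
      using l by (simp add: powr_diff powr_add)
    have lt: "?g x < t" "r < ?g x" using r x l by (simp_all add: t)
    show ?thesis
      using r x l lt
      by (simp add: hadamard_kernel_def 1 2 powr_mult 3[symmetric]) (simp add: mult_ac)
  qed
  have "(\<integral>\<^sup>+s. ennreal (?f s) \<partial>lborel) = (\<integral>\<^sup>+s. ennreal (?f s * indicator {?g 0..?g 1} s) \<partial>lborel)"
    using r by (intro nn_integral_cong) (auto simp: hadamard_kernel_def t indicator_def)
  also have "\<dots> = (\<integral>\<^sup>+x. ennreal (?f (?g x) * (?g x * l) * indicator {0..1} x) \<partial>lborel)"
    using r l
    by (intro nn_integral_substitution[where g = ?g and g' = "\<lambda>x. ?g x * l"])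
       (auto intro!: derivative_eq_intros continuous_intros simp: set_borel_measurable_def)
  also have "\<dots> = (\<integral>\<^sup>+x. ennreal ?C * (ennreal (x powr (c - 1) * (1 - x) powr (a - 1)) * indicator {0..1} x) \<partial>lborel)"
    by (intro nn_integral_cong) (use a c r in \<open>auto simp: f indicator_def ennreal_mult'[symmetric] Gamma_real_pos less_imp_le\<close>)
  also have "\<dots> = ennreal ?C * ennreal (Beta c a)"
    using a c by (subst nn_integral_cmult) (simp_all add: nn_integral_Beta)
  also have "\<dots> = ennreal (?C * Beta c a)"
    using a c r by (intro ennreal_mult'[symmetric]) (simp add: Gamma_real_pos less_imp_le)
  also have "?C * Beta c a = hadamard_kernel (a + c) t r"
    using a c r True Gamma_real_pos[OF a, THEN less_imp_neq] Gamma_real_pos[OF c, THEN less_imp_neq]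
    by (simp add: hadamard_kernel_def Beta_def l_def add.commute)
  finally show ?thesis .
qed

section \<open>The weighted space\<close>

lemma weighted_C_cong:
  assumes "\<And>t. t \<in> {1<..b} \<Longrightarrow> \<phi> t = \<psi> t"
  shows "\<phi> \<in> weighted_C b \<gamma> \<longleftrightarrow> \<psi> \<in> weighted_C b \<gamma>"
  using assms by (simp add: weighted_C_def)

text \<open>Dividing by the positive weight isolates the singularity at 1 in a pure power of the
  logarithm; compactness bounds the other factor.\<close>

lemma weighted_CE:
  assumes "\<phi> \<in> weighted_C b \<gamma>"
  obtains g M where "continuous_on {1..b} g" "\<And>t. t \<in> {1<..b} \<Longrightarrow> \<phi> t = ln t powr (\<gamma> - 1) * g t"
    "\<And>t. t \<in> {1..b} \<Longrightarrow> \<bar>g t\<bar> \<le> M" "0 \<le> M"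
proof -
  from assms obtain g where g: "continuous_on {1..b} g"
    "\<And>t. t \<in> {1<..b} \<Longrightarrow> g t = ln t powr (1 - \<gamma>) * \<phi> t"
    by (auto simp: weighted_C_def)
  have "bounded (g ` {1..b})"
    by (intro compact_imp_bounded compact_continuous_image g) auto
  then obtain M where M: "0 < M" "\<And>t. t \<in> {1..b} \<Longrightarrow> \<bar>g t\<bar> \<le> M"
    by (auto simp: bounded_pos)
  have "\<phi> t = ln t powr (\<gamma> - 1) * g t" if "t \<in> {1<..b}" for t
    using that by (simp add: g powr_add[symmetric] mult.assoc[symmetric])
  with g M that[of g M] show ?thesis by auto
qed

lemma weighted_C_I:
  assumes "continuous_on {1..b} g" "\<And>t. t \<in> {1<..b} \<Longrightarrow> \<phi> t = ln t powr (\<gamma> - 1) * g t"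
  shows "\<phi> \<in> weighted_C b \<gamma>"
  unfolding weighted_C_def
  by (auto intro!: exI[of _ g] simp: assms powr_add[symmetric] mult.assoc[symmetric])

lemma weighted_C_continuous_on:
  assumes "\<phi> \<in> weighted_C b \<gamma>"
  shows "continuous_on {1<..b} \<phi>"
proof -
  from assms obtain g M where g: "continuous_on {1..b} g"
    "\<And>t. t \<in> {1<..b} \<Longrightarrow> \<phi> t = ln t powr (\<gamma> - 1) * g t"
    by (rule weighted_CE) blast
  have "continuous_on {1<..b} (\<lambda>t. ln t powr (\<gamma> - 1) * g t)"
    by (intro continuous_intros continuous_on_subset[OF g(1)]) auto
  then show ?thesis using g(2) by (simp cong: continuous_on_cong_simp)
qed

lemma weighted_C_add:
  assumes "\<phi> \<in> weighted_C b \<gamma>" "\<psi> \<in> weighted_C b \<gamma>"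
  shows "(\<lambda>t. \<phi> t + \<psi> t) \<in> weighted_C b \<gamma>"
proof -
  from assms(1) obtain g M where g: "continuous_on {1..b} g"
    "\<And>t. t \<in> {1<..b} \<Longrightarrow> \<phi> t = ln t powr (\<gamma> - 1) * g t"
    by (rule weighted_CE) blast
  from assms(2) obtain h N where h: "continuous_on {1..b} h"
    "\<And>t. t \<in> {1<..b} \<Longrightarrow> \<psi> t = ln t powr (\<gamma> - 1) * h t"
    by (rule weighted_CE) blast
  from g h show ?thesis
    by (intro weighted_C_I[where g = "\<lambda>t. g t + h t"]) (auto intro!: continuous_intros simp: algebra_simps)
qed

lemma continuous_on_ln_powr: "0 < p \<Longrightarrow> continuous_on {1..b} (\<lambda>t. ln t powr p)" for b p :: real
  by (intro continuous_on_powr' continuous_on_ln continuous_on_id continuous_on_const) auto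

lemma weighted_C_power: "(\<lambda>t. c * ln t powr (\<gamma> - 1)) \<in> weighted_C b \<gamma>"
  by (rule weighted_C_I[where g = "\<lambda>t. c"]) auto

section \<open>Kernel representation and semigroup law\<close>

text \<open>For s > 1 the singular weight \<open>ln s powr (\<gamma> - 1)\<close> is itself s times
  \<open>Gamma \<gamma> * hadamard_kernel \<gamma> s 1\<close>, and s > 1 lies in a bounded range;
  the integrand is thus compared with a product of two kernels, whose integral is finite by
  Chapman-Kolmogorov.\<close>

lemma integrable_kernel_mult_weighted_C:
  assumes a: "0 < a" and \<gamma>: "0 < \<gamma>" and \<phi>: "\<phi> \<in> weighted_C b \<gamma>"
  shows "integrable lborel (\<lambda>s. hadamard_kernel a t s * (indicator {1<..b} s * \<phi> s))"
proof (rule integrableI_bounded)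
  from \<phi> obtain g M where g: "continuous_on {1..b} g"
    "\<And>t. t \<in> {1<..b} \<Longrightarrow> \<phi> t = ln t powr (\<gamma> - 1) * g t"
    "\<And>t. t \<in> {1..b} \<Longrightarrow> \<bar>g t\<bar> \<le> M" "0 \<le> M"
    by (rule weighted_CE) blast
  have [measurable]: "(\<lambda>s. indicator {1<..b} s * \<phi> s) \<in> borel_measurable borel"
    using borel_measurable_continuous_on_indicator[OF _ weighted_C_continuous_on[OF \<phi>]] by simp
  show "(\<lambda>s. hadamard_kernel a t s * (indicator {1<..b} s * \<phi> s)) \<in> borel_measurable lborel"
    by measurable
  have "ennreal (norm (hadamard_kernel a t s * (indicator {1<..b} s * \<phi> s)))
    \<le> ennreal (M * Gamma \<gamma>) * ennreal (hadamard_kernel a t s * hadamard_kernel \<gamma> s 1)" for s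
  proof (cases "s \<in> {1<..b}")
    case True
    have "\<bar>\<phi> s\<bar> = ln s powr (\<gamma> - 1) * \<bar>g s\<bar>" using True g(2) by (simp add: abs_mult)
    also have "\<dots> \<le> ln s powr (\<gamma> - 1) * M" using True g(3) by (intro mult_left_mono) auto
    also have "\<dots> = M * Gamma \<gamma> * hadamard_kernel \<gamma> s 1"
      using True Gamma_real_pos[OF \<gamma>] by (simp add: hadamard_kernel_def)
    finally have "\<bar>\<phi> s\<bar> \<le> M * Gamma \<gamma> * hadamard_kernel \<gamma> s 1" .
    from mult_left_mono[OF this hadamard_kernel_nonneg[OF a, of t s]] True
    show ?thesis using hadamard_kernel_nonneg[OF a, of t s] g(4) Gamma_real_pos[OF \<gamma>]
      by (auto simp: ennreal_mult'[symmetric] abs_mult mult_ac intro!: ennreal_leI)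
  qed auto
  then have "(\<integral>\<^sup>+s. ennreal (norm (hadamard_kernel a t s * (indicator {1<..b} s * \<phi> s))) \<partial>lborel)
    \<le> (\<integral>\<^sup>+s. ennreal (M * Gamma \<gamma>) * ennreal (hadamard_kernel a t s * hadamard_kernel \<gamma> s 1) \<partial>lborel)"
    by (rule nn_integral_mono)
  also have "\<dots> = ennreal (M * Gamma \<gamma>) * ennreal (hadamard_kernel (a + \<gamma>) t 1)"
    using a \<gamma> by (subst nn_integral_cmult) (simp_all add: hadamard_kernel_chapman_kolmogorov)
  also have "\<dots> < \<infinity>" by (simp add: ennreal_mult_less_top)
  finally show "(\<integral>\<^sup>+s. ennreal (norm (hadamard_kernel a t s * (indicator {1<..b} s * \<phi> s))) \<partial>lborel) < \<infinity>" .
qed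

text \<open>The equality is pointwise, not merely almost everywhere: at s = t the kernel is cut off
  and \<open>0 powr (a - 1) = 0\<close> on the other side.\<close>

lemma hadamard_integrand_eq_kernel:
  assumes a: "0 < a" and t: "t \<in> {1<..b}"
  shows "indicator {1<..t} s *\<^sub>R (ln (t / s) powr (a - 1) * \<phi> s / s)
    = Gamma a * (hadamard_kernel a t s * (indicator {1<..b} s * \<phi> s))"
  using t Gamma_real_pos[OF a] by (auto simp: hadamard_kernel_def indicator_def)

lemma hadamard_integral_eq_kernel:
  assumes a: "0 < a" and t: "t \<in> {1<..b}"
  shows "hadamard_integral a \<phi> t = (\<integral>s. hadamard_kernel a t s * (indicator {1<..b} s * \<phi> s) \<partial>lborel)"
  using Gamma_real_pos[OF a, THEN less_imp_neq] a
  by (simp add: hadamard_integral_def set_lebesgue_integral_def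
      hadamard_integrand_eq_kernel[OF a t] del: real_scaleR_def)

lemma set_integrable_hadamard:
  assumes "0 < a" "0 < \<gamma>" "\<phi> \<in> weighted_C b \<gamma>" "t \<in> {1<..b}"
  shows "set_integrable lborel {1<..t} (\<lambda>s. ln (t / s) powr (a - 1) * \<phi> s / s)"
  unfolding set_integrable_def hadamard_integrand_eq_kernel[OF assms(1,4)]
  by (rule integrable_mult_right[OF integrable_kernel_mult_weighted_C[OF assms(1-3)]])

lemma hadamard_integral_cong:
  assumes "\<And>s. s \<in> {1<..b} \<Longrightarrow> \<phi> s = \<psi> s" "t \<in> {1<..b}"
  shows "hadamard_integral a \<phi> t = hadamard_integral a \<psi> t"
  unfolding hadamard_integral_def using assms by (auto intro!: set_lebesgue_integral_cong)

lemma hadamard_integral_cmult: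
  "hadamard_integral a (\<lambda>s. c * \<phi> s) t = c * hadamard_integral a \<phi> t"
proof -
  have "ln (t / s) powr (a - 1) * (c * \<phi> s) / s = c * (ln (t / s) powr (a - 1) * \<phi> s / s)" for s
    by simp
  then show ?thesis by (simp add: hadamard_integral_def del: times_divide_eq_right) simp
qed

lemma hadamard_integral_add:
  assumes "0 \<le> a" "0 < \<gamma>" "\<phi> \<in> weighted_C b \<gamma>" "\<psi> \<in> weighted_C b \<gamma>" "t \<in> {1<..b}"
  shows "hadamard_integral a (\<lambda>s. \<phi> s + \<psi> s) t = hadamard_integral a \<phi> t + hadamard_integral a \<psi> t"
proof (cases "a = 0")
  case False
  with assms have a: "0 < a" by simp
  have "ln (t / s) powr (a - 1) * (\<phi> s + \<psi> s) / s =
    ln (t / s) powr (a - 1) * \<phi> s / s + ln (t / s) powr (a - 1) * \<psi> s / s" for s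
    by (simp add: algebra_simps add_divide_distrib)
  with a assms show ?thesis
    by (simp add: hadamard_integral_def set_integral_add set_integrable_hadamard add_divide_distrib)
qed (simp add: hadamard_integral_def)

text \<open>Exchanging the order of integration lets the s-integral act on the two kernels alone,
  where Chapman-Kolmogorov applies.\<close>

lemma hadamard_integral_semigroup:
  assumes a: "0 < a" and c: "0 < c" and \<gamma>: "0 < \<gamma>" and \<phi>: "\<phi> \<in> weighted_C b \<gamma>" and t: "t \<in> {1<..b}"
  shows "hadamard_integral a (hadamard_integral c \<phi>) t = hadamard_integral (a + c) \<phi> t"
proof -
  let ?\<phi> = "\<lambda>r. indicator {1<..b} r * \<phi> r"
  let ?P = "\<lambda>s r. hadamard_kernel a t s * hadamard_kernel c s r * ?\<phi> r"
  have [measurable]: "?\<phi> \<in> borel_measurable borel"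
    using borel_measurable_continuous_on_indicator[OF _ weighted_C_continuous_on[OF \<phi>]] by simp
  have ck: "(\<integral>\<^sup>+s. ennreal (hadamard_kernel a t s * hadamard_kernel c s r) \<partial>lborel)
    = ennreal (hadamard_kernel (a + c) t r)" if "0 < r" for r
    by (rule hadamard_kernel_chapman_kolmogorov[OF a c that])
  have ck': "(\<integral>s. hadamard_kernel a t s * hadamard_kernel c s r \<partial>lborel) = hadamard_kernel (a + c) t r"
    if "0 < r" for r
    using a c hadamard_kernel_nonneg
    by (subst integral_eq_nn_integral) (auto simp: ck[OF that])
  have fin: "(\<integral>\<^sup>+r. ennreal (norm (hadamard_kernel (a + c) t r * ?\<phi> r)) \<partial>lborel) < \<infinity>"
    using integrable_kernel_mult_weighted_C[OF _ \<gamma> \<phi>, of "a + c" t] a c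
    by (simp add: integrable_iff_bounded)
  \<comment> \<open>Tonelli, integrating over s first, reduces the integrability needed for Fubini
    to that of the single kernel of order \<open>a + c\<close>.\<close>
  have "(\<integral>\<^sup>+p. ennreal (norm (case_prod ?P p)) \<partial>(lborel \<Otimes>\<^sub>M lborel))
    = (\<integral>\<^sup>+r. \<integral>\<^sup>+s. ennreal (norm (?P s r)) \<partial>lborel \<partial>lborel)"
    by (subst lborel_pair.nn_integral_snd[symmetric]) (auto simp: split_beta')
  also have "\<dots> = (\<integral>\<^sup>+r. ennreal (norm (hadamard_kernel (a + c) t r * ?\<phi> r)) \<partial>lborel)"
  proof (rule nn_integral_cong)
    fix r
    show "(\<integral>\<^sup>+s. ennreal (norm (?P s r)) \<partial>lborel) = ennreal (norm (hadamard_kernel (a + c) t r * ?\<phi> r))"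
    proof (cases "r \<in> {1<..b}")
      case True
      have "(\<integral>\<^sup>+s. ennreal (norm (?P s r)) \<partial>lborel)
        = (\<integral>\<^sup>+s. ennreal (hadamard_kernel a t s * hadamard_kernel c s r) * ennreal \<bar>?\<phi> r\<bar> \<partial>lborel)"
        using a c hadamard_kernel_nonneg
        by (intro nn_integral_cong) (simp add: abs_mult ennreal_mult'')
      also have "\<dots> = ennreal (hadamard_kernel (a + c) t r) * ennreal \<bar>?\<phi> r\<bar>"
        using True ck by (subst nn_integral_multc) auto
      finally show ?thesis using a c hadamard_kernel_nonneg[of "a + c"]
        by (simp add: abs_mult ennreal_mult'')
    qed auto
  qed
  finally have "integrable (lborel \<Otimes>\<^sub>M lborel) (case_prod ?P)"
    using fin by (intro integrableI_bounded) auto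
  then have fubini: "(\<integral>r. (\<integral>s. ?P s r \<partial>lborel) \<partial>lborel) = (\<integral>s. (\<integral>r. ?P s r \<partial>lborel) \<partial>lborel)"
    by (rule lborel_pair.Fubini_integral)
  have inner1: "(\<integral>s. ?P s r \<partial>lborel) = hadamard_kernel (a + c) t r * ?\<phi> r" for r
    by (cases "r \<in> {1<..b}") (auto simp: ck')
  \<comment> \<open>The indicator in s may be inserted freely: for s \<le> 1 no r > 1 satisfies r <
    s, and for s \<ge> t the outer kernel is zero.\<close>
  have inner2: "(\<integral>r. ?P s r \<partial>lborel) =
    hadamard_kernel a t s * (indicator {1<..b} s * hadamard_integral c \<phi> s)" for s
  proof (cases "s \<in> {1<..<t}")
    case True
    with t c have "hadamard_integral c \<phi> s = (\<integral>r. hadamard_kernel c s r * ?\<phi> r \<partial>lborel)"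
      by (intro hadamard_integral_eq_kernel) auto
    with True t show ?thesis by (simp add: mult.assoc)
  next
    case False
    with t have z: "?P s r = 0" "hadamard_kernel a t s * (indicator {1<..b} s * hadamard_integral c \<phi> s) = 0" for r
      by (auto simp: hadamard_kernel_def indicator_def)
    show ?thesis unfolding z by simp
  qed
  from fubini have "(\<integral>r. hadamard_kernel (a + c) t r * ?\<phi> r \<partial>lborel)
    = (\<integral>s. hadamard_kernel a t s * (indicator {1<..b} s * hadamard_integral c \<phi> s) \<partial>lborel)"
    by (simp only: inner1 inner2)
  with a c show ?thesis by (simp only: hadamard_integral_eq_kernel[OF _ t] add_pos_pos)
qed

section \<open>Behaviour of Hadamard integrals near 1\<close>

text \<open>Under s = t^x the logarithms become \<open>ln t * (1 - x)\<close> and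
  \<open>x * ln t\<close>. Collecting the powers of \<open>ln t\<close>, including the one from the
  Jacobian, gives the exponent \<open>a + \<gamma> - 1\<close>; the remaining integral depends on t
  only through the argument of g.\<close>

lemma hadamard_integral_scaled:
  assumes a: "0 < a" and \<gamma>: "0 < \<gamma>" and g: "continuous_on {1..b} g"
    and \<phi>: "\<And>t. t \<in> {1<..b} \<Longrightarrow> \<phi> t = ln t powr (\<gamma> - 1) * g t" and t: "t \<in> {1<..b}"
  shows "hadamard_integral a \<phi> t = ln t powr (a + \<gamma> - 1) *
    ((\<integral>x. indicator {0..1} x * (x powr (\<gamma> - 1) * (1 - x) powr (a - 1)) * g (exp (x * ln t)) \<partial>lborel) / Gamma a)"
proof -
  let ?l = "ln t" and ?e = "\<lambda>x. exp (x * ln t)"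
  let ?f = "\<lambda>s. hadamard_kernel a t s * (indicator {1<..b} s * \<phi> s)"
  have l: "0 < ?l" and et: "exp ?l = t" using t by simp_all
  have "\<phi> \<in> weighted_C b \<gamma>" using g \<phi> by (rule weighted_C_I)
  then have int: "set_integrable lborel {?e 0..?e 1} ?f"
    unfolding set_integrable_def
    by (intro integrable_mult_indicator integrable_kernel_mult_weighted_C[OF a \<gamma>]) auto
  have f: "?f (?e x) * (?e x * ?l) * indicator {0..1} x = ?l powr (a + \<gamma> - 1) / Gamma a *
    (indicator {0..1} x * (x powr (\<gamma> - 1) * (1 - x) powr (a - 1)) * g (?e x))" for x
  proof (cases "0 < x \<and> x < 1")
    case True
    have 1: "ln (t / ?e x) = ?l * (1 - x)" using t
      by (simp add: ln_div algebra_simps)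
    have 2: "?l powr (a - 1) * ?l powr (\<gamma> - 1) * ?l = ?l powr (a + \<gamma> - 1)"
      using l by (simp add: powr_diff powr_add)
    have "?e x < exp ?l" using True l by simp
    then have lt: "?e x < t" "1 < ?e x" using True l by (simp_all add: et)
    show ?thesis
      using True t l lt
      by (simp add: hadamard_kernel_def 1 \<phi> powr_mult 2[symmetric])
  next
    case False
    then have "x \<notin> {0..1} \<or> x = 0 \<or> x = 1" by auto
    then show ?thesis using t by (auto simp: hadamard_kernel_def)
  qed
  have "hadamard_integral a \<phi> t = (\<integral>s. ?f s * indicator {?e 0..?e 1} s \<partial>lborel)"
    unfolding hadamard_integral_eq_kernel[OF a t]
    using t by (intro Bochner_Integration.integral_cong) (auto simp: hadamard_kernel_def indicator_def)
  also have "\<dots> = (\<integral>x. ?f (?e x) * (?e x * ?l) * indicator {0..1} x \<partial>lborel)"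
    using l by (intro integral_substitution(2)[where g = ?e and g' = "\<lambda>x. ?e x * ?l"] int)
       (auto intro!: derivative_eq_intros continuous_intros)
  also have "\<dots> = ?l powr (a + \<gamma> - 1) / Gamma a * (\<integral>x.
    indicator {0..1} x * (x powr (\<gamma> - 1) * (1 - x) powr (a - 1)) * g (?e x) \<partial>lborel)"
    unfolding f by (rule integral_mult_right_zero)
  finally show ?thesis by simp
qed

text \<open>Dominated convergence, with a constant multiple of the integrable Beta density as
  majorant. The point t = 1 is included, which is what membership in the weighted space
  requires.\<close>

lemma continuous_on_scaled_Beta_integral:
  fixes a b \<gamma> :: real and g :: "real \<Rightarrow> real"
  assumes a: "0 < a" and \<gamma>: "0 < \<gamma>" and g: "continuous_on {1..b} g"
  shows "continuous_on {1..b} (\<lambda>t. \<integral>x. indicator {0..1} x *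
    (x powr (\<gamma> - 1) * (1 - x) powr (a - 1)) * g (exp (x * ln t)) \<partial>lborel)"
proof -
  \<comment> \<open>Clamping the argument to [1,b] extends g to a bounded continuous function on the
    whole line, so measurability and the bound hold for every x.\<close>
  define h where "h t = g (max 1 (min b t))" for t
  let ?B = "\<lambda>x. indicator {0..1} x * (x powr (\<gamma> - 1) * (1 - x) powr (a - 1))"
  show ?thesis
  proof (cases "1 \<le> b")
    case True
    have h: "continuous_on UNIV h"
      unfolding h_def using True
      by (intro continuous_on_compose2[OF g] continuous_on_max continuous_on_min
          continuous_on_id continuous_on_const) (auto simp: max_def)
    then have [measurable]: "h \<in> borel_measurable borel" by (rule borel_measurable_continuous_onI)
    have "bounded (g ` {1..b})"
      by (intro compact_imp_bounded compact_continuous_image g) auto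
    then obtain M where M: "0 < M" "\<And>t. t \<in> {1..b} \<Longrightarrow> \<bar>g t\<bar> \<le> M"
      by (auto simp: bounded_pos)
    then have hM: "\<bar>h t\<bar> \<le> M" for t using True by (simp add: h_def)
    have B: "integrable lborel ?B" using integrable_Beta[OF \<gamma> a] by (simp add: set_integrable_def)
    have cont: "continuous_on {1..b} (\<lambda>t. \<integral>x. ?B x * h (exp (x * ln t)) \<partial>lborel)"
      unfolding continuous_on_sequentially
    proof (intro allI ballI impI, clarify)
      fix X :: "nat \<Rightarrow> real" and t assume X: "\<forall>n. X n \<in> {1..b}" "X \<longlonglongrightarrow> t" "t \<in> {1..b}"
      have lim: "(\<lambda>n. h (exp (x * ln (X n)))) \<longlonglongrightarrow> h (exp (x * ln t))" for x
        using X by (intro continuous_on_tendsto_compose[OF h] tendsto_intros) auto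
      show "((\<lambda>t. \<integral>x. ?B x * h (exp (x * ln t)) \<partial>lborel) \<circ> X) \<longlonglongrightarrow>
        (\<integral>x. ?B x * h (exp (x * ln t)) \<partial>lborel)"
        unfolding comp_def
      proof (rule integral_dominated_convergence[where w = "\<lambda>x. ?B x * M"])
        show "AE x in lborel. norm (?B x * h (exp (x * ln (X n)))) \<le> ?B x * M" for n
          using hM by (intro AE_I2) (auto simp: abs_mult intro!: mult_left_mono)
        show "AE x in lborel. (\<lambda>n. ?B x * h (exp (x * ln (X n)))) \<longlonglongrightarrow> ?B x * h (exp (x * ln t))"
          by (intro AE_I2 tendsto_mult tendsto_const lim)
        show "integrable lborel (\<lambda>x. ?B x * M)" using B by (rule integrable_mult_left)
      qed measurable
    qed
    \<comment> \<open>The clamping is invisible here: for x in [0,1] the point t^x lies between 1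
      and t.\<close>
    have eq: "?B x * h (exp (x * ln t)) = ?B x * g (exp (x * ln t))" if "t \<in> {1..b}" for x t
    proof (cases "x \<in> {0..1}")
      case True
      with that have "exp (x * ln t) \<le> exp (1 * ln t)" "exp 0 \<le> exp (x * ln t)"
        by (simp_all only: exp_le_cancel_iff) (use that in \<open>auto intro!: mult_left_le_one_le\<close>)
      with that have "exp (x * ln t) \<in> {1..b}" by auto
      then show ?thesis by (simp add: h_def)
    qed simp
    from cont show ?thesis by (rule continuous_on_eq) (simp only: eq)
  qed simp
qed

lemma hadamard_integral_weighted_CE:
  assumes "0 < a" "0 < \<gamma>" "\<phi> \<in> weighted_C b \<gamma>"
  obtains G where "continuous_on {1..b} G"
    "\<And>t. t \<in> {1<..b} \<Longrightarrow> hadamard_integral a \<phi> t = ln t powr (a + \<gamma> - 1) * G t"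
proof -
  from assms(3) obtain g M where g: "continuous_on {1..b} g"
    "\<And>t. t \<in> {1<..b} \<Longrightarrow> \<phi> t = ln t powr (\<gamma> - 1) * g t"
    by (rule weighted_CE) blast
  show ?thesis
    using assms g
    by (intro that[OF _ hadamard_integral_scaled[OF assms(1,2) g]] continuous_on_divide
        continuous_on_scaled_Beta_integral continuous_on_const)
       (auto simp: Gamma_real_pos[THEN less_imp_neq, symmetric])
qed

text \<open>Relative to the weight, integration of order a > 0 gains the factor
  \<open>ln t powr a\<close>, which is continuous up to t = 1.\<close>

lemma weighted_C_hadamard_integral:
  assumes "0 \<le> a" "0 < \<gamma>" "\<phi> \<in> weighted_C b \<gamma>"
  shows "hadamard_integral a \<phi> \<in> weighted_C b \<gamma>"
proof (cases "a = 0")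
  case True
  then have "hadamard_integral a \<phi> = \<phi>" by (simp add: hadamard_integral_def fun_eq_iff)
  with assms show ?thesis by simp
next
  case False
  with assms have a: "0 < a" by simp
  obtain G where G: "continuous_on {1..b} G"
    "\<And>t. t \<in> {1<..b} \<Longrightarrow> hadamard_integral a \<phi> t = ln t powr (a + \<gamma> - 1) * G t"
    using hadamard_integral_weighted_CE[OF a assms(2,3)] by blast
  show ?thesis
  proof (rule weighted_C_I)
    show "continuous_on {1..b} (\<lambda>t. ln t powr a * G t)"
      by (intro continuous_on_mult continuous_on_ln_powr a G)
    show "hadamard_integral a \<phi> t = ln t powr (\<gamma> - 1) * (ln t powr a * G t)" if "t \<in> {1<..b}" for t
      using that powr_add[of "ln t" "\<gamma> - 1" a] by (simp add: G algebra_simps)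
  qed
qed

text \<open>The exponent \<open>a + \<gamma> - 1\<close> is positive, so the power of the logarithm
  tends to 0 while its cofactor stays continuous at 1.\<close>

lemma hadamard_integral_tendsto_0:
  assumes b: "1 < b" and "0 < a" "0 < \<gamma>" "1 < a + \<gamma>" "\<phi> \<in> weighted_C b \<gamma>"
  shows "(hadamard_integral a \<phi> \<longlongrightarrow> 0) (at_right 1)"
proof -
  obtain G where G: "continuous_on {1..b} G"
    "\<And>t. t \<in> {1<..b} \<Longrightarrow> hadamard_integral a \<phi> t = ln t powr (a + \<gamma> - 1) * G t"
    using hadamard_integral_weighted_CE assms by blast
  have "continuous_on {1..b} (\<lambda>t. ln t powr (a + \<gamma> - 1) * G t)"
    using assms by (intro continuous_on_mult continuous_on_ln_powr G) auto
  then have "((\<lambda>t. ln t powr (a + \<gamma> - 1) * G t) \<longlongrightarrow> ln 1 powr (a + \<gamma> - 1) * G 1) (at_right 1)"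
    by (rule continuous_on_Icc_at_rightD[OF _ b])
  moreover have "eventually (\<lambda>t. t \<in> {1<..<b}) (at_right 1)"
    by (rule eventually_at_right_real[OF b])
  then have "eventually (\<lambda>t. hadamard_integral a \<phi> t = ln t powr (a + \<gamma> - 1) * G t) (at_right 1)"
    by eventually_elim (use G in auto)
  ultimately show ?thesis by (subst tendsto_cong) simp_all
qed

text \<open>This is the scaling formula with constant g, so the integral is exactly a Beta value.
  For \<open>a = 1 - \<gamma>\<close> the result is the constant 1, which identifies the homogeneous
  term of the representation.\<close>

lemma hadamard_integral_power:
  assumes a: "0 < a" and \<gamma>: "0 < \<gamma>" and t: "1 < t"
  shows "hadamard_integral a (\<lambda>s. ln s powr (\<gamma> - 1) / Gamma \<gamma>) t = ln t powr (a + \<gamma> - 1) / Gamma (a + \<gamma>)"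
proof -
  have "hadamard_integral a (\<lambda>s. ln s powr (\<gamma> - 1) / Gamma \<gamma>) t = ln t powr (a + \<gamma> - 1) *
    ((\<integral>x. indicator {0..1} x * (x powr (\<gamma> - 1) * (1 - x) powr (a - 1)) * (1 / Gamma \<gamma>) \<partial>lborel) / Gamma a)"
    using t by (intro hadamard_integral_scaled[OF a \<gamma>, where b = t and g = "\<lambda>_. 1 / Gamma \<gamma>"]) auto
  also have "(\<integral>x. indicator {0..1} x * (x powr (\<gamma> - 1) * (1 - x) powr (a - 1)) * (1 / Gamma \<gamma>) \<partial>lborel)
    = (\<integral>x. indicator {0..1} x * (x powr (\<gamma> - 1) * (1 - x) powr (a - 1)) \<partial>lborel) / Gamma \<gamma>"
    by simp
  also have "(\<integral>x. indicator {0..1} x * (x powr (\<gamma> - 1) * (1 - x) powr (a - 1)) \<partial>lborel) = Beta \<gamma> a"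
    using set_borel_integral_eq_integral(2)[OF integrable_Beta[OF \<gamma> a]]
      integral_unique[OF has_integral_Beta_real[OF \<gamma> a]]
    by (simp add: set_lebesgue_integral_def)
  finally show ?thesis
    using Gamma_real_pos[OF a, THEN less_imp_neq] Gamma_real_pos[OF \<gamma>, THEN less_imp_neq]
    by (simp add: Beta_def add.commute)
qed

section \<open>Differentiation and injectivity\<close>

text \<open>Order 1 is the ordinary integral of \<open>\<phi> s / s\<close>. As \<phi> may be
  singular at 1, the fundamental theorem is used in the form that asks for integrability on the
  closed interval and continuity only at t, with the point 1 removed.\<close>

lemma hadamard_integral_one_has_vector_derivative:
  assumes \<gamma>: "0 < \<gamma>" and \<phi>: "\<phi> \<in> weighted_C b \<gamma>" and t: "t \<in> {1<..b}"
  shows "(hadamard_integral 1 \<phi> has_vector_derivative \<phi> t / t) (at t within {1<..b})"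
proof -
  let ?h = "\<lambda>s. \<phi> s / s"
  have [measurable]: "(\<lambda>s. indicator {1<..b} s * \<phi> s) \<in> borel_measurable borel"
    using borel_measurable_continuous_on_indicator[OF _ weighted_C_continuous_on[OF \<phi>]] by simp
  have ae: "AE s in lborel. hadamard_kernel 1 x s * (indicator {1<..b} s * \<phi> s) = indicator {1..x} s *\<^sub>R ?h s"
    if "x \<in> {1<..b}" for x
    using AE_lborel_singleton[of 1] AE_lborel_singleton[of x]
    by eventually_elim (use that in \<open>auto simp: hadamard_kernel_def indicator_def\<close>)
  have meas: "(\<lambda>s. indicator {1..x} s *\<^sub>R ?h s) \<in> borel_measurable lborel" if "x \<in> {1<..b}" for x
  proof -
    \<comment> \<open>The value of \<phi> at 1 is arbitrary, so that point is split off as a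
      separate measurable term.\<close>
    have "(\<lambda>s. indicator {1..x} s *\<^sub>R ?h s) =
      (\<lambda>s. indicator {1<..x} s * (indicator {1<..b} s * \<phi> s) / s + indicator {1} s * \<phi> 1)"
      using that by (auto simp: fun_eq_iff indicator_def)
    then show ?thesis by simp
  qed
  have int: "set_integrable lborel {1..x} ?h" if "x \<in> {1<..b}" for x
    unfolding set_integrable_def
    using integrable_kernel_mult_weighted_C[OF zero_less_one \<gamma> \<phi>, of x] meas[OF that]
    by (subst integrable_cong_AE[OF _ _ ae[OF that], symmetric]) auto
  have eq: "hadamard_integral 1 \<phi> x = integral {1..x} ?h" if "x \<in> {1<..b}" for x
  proof -
    have "hadamard_integral 1 \<phi> x = (LBINT s:{1..x}. ?h s)"
      unfolding hadamard_integral_eq_kernel[OF zero_less_one that] set_lebesgue_integral_def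
      by (intro integral_cong_AE meas ae that) measurable
    then show ?thesis using set_borel_integral_eq_integral(2)[OF int[OF that]] by simp
  qed
  have Ioc: "{1..b} - {1} = {1<..b}" by auto
  have "continuous_on {1<..b} ?h"
    by (intro continuous_intros weighted_C_continuous_on[OF \<phi>]) auto
  then have cont: "continuous (at t within {1..b} - {1}) ?h"
    using t unfolding Ioc by (simp add: continuous_on_eq_continuous_within)
  have "((\<lambda>x. integral {1..x} ?h) has_vector_derivative ?h t) (at t within {1..b} - {1})"
    using t by (intro integral_has_vector_derivative_continuous_at cont
        set_borel_integral_eq_integral(1) int) auto
  then have "((\<lambda>x. integral {1..x} ?h) has_vector_derivative ?h t) (at t within {1<..b})"
    unfolding Ioc .
  then show ?thesis
    by (rule has_vector_derivative_transform[OF t eq, rotated])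
qed

lemma at_within_Ioc_ne_bot: "t \<in> {a<..b} \<Longrightarrow> at t within {a<..b} \<noteq> bot" for a b :: real
  by (simp add: trivial_limit_within)

text \<open>Applying the integral of order \<open>1 - a\<close> raises both sides to order 1, where
  differentiation recovers the functions. The case a = 1 stands apart because the semigroup law is
  for positive orders.\<close>

lemma hadamard_integral_injective:
  assumes a: "0 < a" "a \<le> 1" and \<gamma>: "0 < \<gamma>" and \<phi>: "\<phi> \<in> weighted_C b \<gamma>" and \<psi>: "\<psi> \<in> weighted_C b \<gamma>"
    and eq: "\<And>t. t \<in> {1<..b} \<Longrightarrow> hadamard_integral a \<phi> t = hadamard_integral a \<psi> t"
    and t: "t \<in> {1<..b}"
  shows "\<phi> t = \<psi> t"
proof -
  have eq1: "hadamard_integral 1 \<phi> s = hadamard_integral 1 \<psi> s" if "s \<in> {1<..b}" for s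
  proof (cases "a = 1")
    case True
    with eq that show ?thesis by simp
  next
    case False
    with a have "0 < 1 - a" by simp
    from hadamard_integral_semigroup[OF this a(1) \<gamma> \<phi> that]
      hadamard_integral_semigroup[OF this a(1) \<gamma> \<psi> that]
      hadamard_integral_cong[OF eq that]
    show ?thesis by simp
  qed
  have "(hadamard_integral 1 \<phi> has_vector_derivative \<psi> t / t) (at t within {1<..b})"
    using hadamard_integral_one_has_vector_derivative[OF \<gamma> \<psi> t]
    by (rule has_vector_derivative_transform[OF t eq1, rotated])
  moreover note at_within_Ioc_ne_bot[OF t]
  ultimately have "\<psi> t / t = \<phi> t / t"
    using hadamard_integral_one_has_vector_derivative[OF \<gamma> \<phi> t] vector_derivative_unique_within by blast
  with t show ?thesis by simp
qed

section \<open>Representation of functions with a weighted derivative\<close>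

lemma weighted_C_deriv_representation:
  assumes \<gamma>: "0 < \<gamma>" "\<gamma> < 1" and u: "u \<in> weighted_C_deriv b \<gamma>"
  obtains L where
    "\<And>t. t \<in> {1<..b} \<Longrightarrow> hadamard_integral (1 - \<gamma>) u t =
      L + hadamard_integral 1 (hadamard_derivative b \<gamma> u) t"
    "\<And>t. t \<in> {1<..b} \<Longrightarrow> u t = L * ln t powr (\<gamma> - 1) / Gamma \<gamma> +
      hadamard_integral \<gamma> (hadamard_derivative b \<gamma> u) t"
proof -
  define w where "w = hadamard_derivative b \<gamma> u"
  let ?U = "hadamard_integral (1 - \<gamma>) u"
  from u have uC: "u \<in> weighted_C b \<gamma>" and wC: "w \<in> weighted_C b \<gamma>"
    and diff: "?U differentiable_on {1<..b}"
    by (auto simp: weighted_C_deriv_def hadamard_derivative_exists_def w_def)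
  have deriv: "((\<lambda>t. ?U t - hadamard_integral 1 w t) has_vector_derivative 0) (at t within {1<..b})"
    if t: "t \<in> {1<..b}" for t
  proof -
    have "(?U has_vector_derivative w t / t) (at t within {1<..b})"
      using diff t by (simp add: differentiable_on_def vector_derivative_works w_def
          hadamard_derivative_def log_deriv_def)
    from has_vector_derivative_diff[OF this hadamard_integral_one_has_vector_derivative[OF \<gamma>(1) wC t]]
    show ?thesis by simp
  qed
  \<comment> \<open>A vanishing derivative on the convex set (1,b] forces a constant; no limit at 1
    is needed to obtain \<open>L\<close>.\<close>
  have "\<exists>L. \<forall>t\<in>{1<..b}. ?U t - hadamard_integral 1 w t = L"
    using deriv by (intro has_derivative_zero_constant) (auto simp: has_vector_derivative_def)
  then obtain L where "\<forall>t\<in>{1<..b}. ?U t - hadamard_integral 1 w t = L" ..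
  then have L: "?U t = L + hadamard_integral 1 w t" if "t \<in> {1<..b}" for t
    using that by (fastforce simp: algebra_simps)
  \<comment> \<open>The candidate is chosen so that the integral of order
    \<open>1 - \<gamma>\<close> sends it to \<open>L + hadamard_integral 1 w t\<close>, the value
    already found for u; injectivity then identifies the two.\<close>
  let ?v = "\<lambda>t. L * (ln t powr (\<gamma> - 1) / Gamma \<gamma>) + hadamard_integral \<gamma> w t"
  have pC: "(\<lambda>t. L * (ln t powr (\<gamma> - 1) / Gamma \<gamma>)) \<in> weighted_C b \<gamma>"
    using weighted_C_power[of "L / Gamma \<gamma>"] by simp
  have IC: "hadamard_integral \<gamma> w \<in> weighted_C b \<gamma>"
    using \<gamma> wC by (intro weighted_C_hadamard_integral) auto
  have "u t = ?v t" if t: "t \<in> {1<..b}" for t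
  proof (rule hadamard_integral_injective[OF _ _ \<gamma>(1) uC weighted_C_add[OF pC IC] _ t])
    fix t assume t: "t \<in> {1<..b}"
    have "hadamard_integral (1 - \<gamma>) ?v t =
      hadamard_integral (1 - \<gamma>) (\<lambda>t. L * (ln t powr (\<gamma> - 1) / Gamma \<gamma>)) t +
      hadamard_integral (1 - \<gamma>) (hadamard_integral \<gamma> w) t"
      using \<gamma> by (intro hadamard_integral_add[OF _ \<gamma>(1) pC IC t]) simp
    also have "\<dots> = L + hadamard_integral 1 w t"
      using \<gamma> t hadamard_integral_power[of "1 - \<gamma>" \<gamma> t]
        hadamard_integral_semigroup[OF _ \<gamma>(1) \<gamma>(1) wC t, of "1 - \<gamma>"]
      by (simp only: hadamard_integral_cmult) simp
    finally show "hadamard_integral (1 - \<gamma>) u t = hadamard_integral (1 - \<gamma>) ?v t"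
      using L[OF t] by simp
  qed (use \<gamma> in auto)
  with L that[of L] show ?thesis by (simp add: w_def)
qed

text \<open>The integral of order \<open>1 - \<gamma>\<close> turns the power terms into the
  constants k and l, and the other terms into integrals of order
  \<open>1 - \<gamma> + \<alpha>\<close>. Since this order plus \<gamma> is
  \<open>1 + \<alpha> > 1\<close>, those vanish at 1, so k = l. The power terms then cancel and
  injectivity of order \<alpha> gives F = G.\<close>

lemma representation_unique:
  assumes b: "1 < b" and \<alpha>: "0 < \<alpha>" "\<alpha> \<le> 1" and \<gamma>: "0 < \<gamma>" "\<gamma> < 1"
    and F: "F \<in> weighted_C b \<gamma>" and G: "G \<in> weighted_C b \<gamma>"
    and eq: "\<And>t. t \<in> {1<..b} \<Longrightarrow>
      k * ln t powr (\<gamma> - 1) / Gamma \<gamma> + hadamard_integral \<alpha> F t =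
      l * ln t powr (\<gamma> - 1) / Gamma \<gamma> + hadamard_integral \<alpha> G t"
  shows "k = l" and "\<And>t. t \<in> {1<..b} \<Longrightarrow> F t = G t"
proof -
  let ?v = "\<lambda>k F t. k * (ln t powr (\<gamma> - 1) / Gamma \<gamma>) + hadamard_integral \<alpha> F t"
  have I: "hadamard_integral (1 - \<gamma>) (?v k F) t = k + hadamard_integral (1 - \<gamma> + \<alpha>) F t"
    if t: "t \<in> {1<..b}" and F: "F \<in> weighted_C b \<gamma>" for k F t
  proof -
    have pC: "(\<lambda>t. k * (ln t powr (\<gamma> - 1) / Gamma \<gamma>)) \<in> weighted_C b \<gamma>"
      using weighted_C_power[of "k / Gamma \<gamma>"] by simp
    have IC: "hadamard_integral \<alpha> F \<in> weighted_C b \<gamma>"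
      using \<alpha> \<gamma> F by (intro weighted_C_hadamard_integral) auto
    have "hadamard_integral (1 - \<gamma>) (?v k F) t =
      hadamard_integral (1 - \<gamma>) (\<lambda>t. k * (ln t powr (\<gamma> - 1) / Gamma \<gamma>)) t +
      hadamard_integral (1 - \<gamma>) (hadamard_integral \<alpha> F) t"
      using \<gamma> by (intro hadamard_integral_add[OF _ \<gamma>(1) pC IC t]) simp
    also have "\<dots> = k + hadamard_integral (1 - \<gamma> + \<alpha>) F t"
      using \<gamma> t hadamard_integral_power[of "1 - \<gamma>" \<gamma> t]
        hadamard_integral_semigroup[OF _ \<alpha>(1) \<gamma>(1) F t, of "1 - \<gamma>"]
      by (simp only: hadamard_integral_cmult) simp
    finally show ?thesis .
  qed
  have lim: "((\<lambda>t. k + hadamard_integral (1 - \<gamma> + \<alpha>) F t) \<longlongrightarrow> k) (at_right 1)"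
    if F: "F \<in> weighted_C b \<gamma>" for k F
    using tendsto_add[OF tendsto_const hadamard_integral_tendsto_0[OF b _ \<gamma>(1) _ F, of "1 - \<gamma> + \<alpha>"], of k] \<alpha> \<gamma>
    by simp
  have "eventually (\<lambda>t. t \<in> {1<..<b}) (at_right 1)"
    by (rule eventually_at_right_real[OF b])
  then have "eventually (\<lambda>t. k + hadamard_integral (1 - \<gamma> + \<alpha>) F t
    = l + hadamard_integral (1 - \<gamma> + \<alpha>) G t) (at_right 1)"
  proof eventually_elim
    case (elim t)
    then have t: "t \<in> {1<..b}" by auto
    have "hadamard_integral (1 - \<gamma>) (?v k F) t = hadamard_integral (1 - \<gamma>) (?v l G) t"
      using eq by (intro hadamard_integral_cong[OF _ t]) auto
    then show ?case by (simp only: I[OF t F] I[OF t G])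
  qed
  then have "((\<lambda>t. k + hadamard_integral (1 - \<gamma> + \<alpha>) F t) \<longlongrightarrow> l) (at_right 1)"
    using lim[OF G, of l] by (simp add: tendsto_cong)
  with lim[OF F, of k] show kl: "k = l"
    by (rule tendsto_unique[rotated]) (simp add: trivial_limit_at_right_real)
  show "F t = G t" if "t \<in> {1<..b}" for t
    using eq by (intro hadamard_integral_injective[OF \<alpha> \<gamma>(1) F G _ that]) (simp add: kl)
qed

text \<open>Both one-sided limits exist and can be read off: the order-1 integral vanishes at 1 and
  is continuous at b. Uniqueness of limits removes the existential quantifiers.\<close>

lemma boundary_condition_iff:
  assumes b: "1 < b" and \<gamma>: "0 < \<gamma>" and w: "w \<in> weighted_C b \<gamma>"
    and U: "\<And>t. t \<in> {1<..b} \<Longrightarrow> hadamard_integral (1 - \<gamma>) u t = L + hadamard_integral 1 w t"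
  shows "boundary_condition b \<gamma> c\<^sub>1 c\<^sub>2 \<phi> u \<longleftrightarrow> c\<^sub>1 * L + c\<^sub>2 * (L + hadamard_integral 1 w b) = \<phi>"
proof -
  let ?U = "hadamard_integral (1 - \<gamma>) u" and ?V = "\<lambda>t. L + hadamard_integral 1 w t"
  have "(?V \<longlongrightarrow> L) (at_right 1)"
    using tendsto_add[OF tendsto_const hadamard_integral_tendsto_0[OF b _ \<gamma> _ w, of 1], of L] \<gamma> by simp
  moreover have "eventually (\<lambda>t. ?V t = ?U t) (at_right 1)"
    using eventually_at_right_real[OF b] by eventually_elim (use U in auto)
  ultimately have L1: "(?U \<longlongrightarrow> L) (at_right 1)" by (rule Lim_transform_eventually)
  have "hadamard_integral 1 w \<in> weighted_C b \<gamma>"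
    using \<gamma> w by (intro weighted_C_hadamard_integral) auto
  \<comment> \<open>The midpoint serves only as a left end inside (1,b), since continuity of
    \<open>?V\<close> is available there but not at 1 itself.\<close>
  then have "continuous_on {(1 + b) / 2..b} ?V"
    using b by (intro continuous_intros continuous_on_subset[OF weighted_C_continuous_on]) auto
  then have "(?V \<longlongrightarrow> ?V b) (at_left b)"
    by (rule continuous_on_Icc_at_leftD) (use b in auto)
  moreover have "eventually (\<lambda>t. ?V t = ?U t) (at_left b)"
    using eventually_at_left_real[OF b] by eventually_elim (use U in auto)
  ultimately have L2: "(?U \<longlongrightarrow> ?V b) (at_left b)" by (rule Lim_transform_eventually)
  show ?thesis
    unfolding boundary_condition_def
    using L1 L2 tendsto_unique[OF trivial_limit_at_right_real _ L1] tendsto_unique[OF trivial_limit_at_left_real _ L2]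
    by blast
qed

section \<open>Equivalence of the boundary value problem and the integral equation\<close>

theorem lemma3p2:
  fixes b \<alpha> \<beta> \<gamma> c\<^sub>1 c\<^sub>2 \<phi> :: real
    and f :: "real \<Rightarrow> real \<Rightarrow> real \<Rightarrow> real"
    and u :: "real \<Rightarrow> real"
  assumes "1 < b"
    and "0 < \<alpha>" and "\<alpha> < 1"
    and "0 \<le> \<beta>" and "\<beta> \<le> 1"
    and "\<gamma> = \<alpha> + \<beta> - \<alpha> * \<beta>" and "\<gamma> < 1"
    and "c\<^sub>1 + c\<^sub>2 \<noteq> 0" and "c\<^sub>2 \<noteq> 0"
    and "\<And>v. v \<in> weighted_C b \<gamma> \<Longrightarrow> hilfer_hadamard_exists b \<alpha> \<beta> v \<Longrightarrow>
           (\<lambda>t. f t (v t) (hilfer_hadamard b \<alpha> \<beta> v t)) \<in> weighted_C b \<gamma>"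
    and "u \<in> weighted_C_deriv b \<gamma>"
  shows "((\<forall>t\<in>{1<..b}. hilfer_hadamard b \<alpha> \<beta> u t = f t (u t) (hilfer_hadamard b \<alpha> \<beta> u t)) \<and>
            boundary_condition b \<gamma> c\<^sub>1 c\<^sub>2 \<phi> u
          \<longleftrightarrow> (\<exists>F. implicit_rhs b \<gamma> f u F \<and> integral_equation b \<alpha> \<gamma> c\<^sub>1 c\<^sub>2 \<phi> F u))
       \<and> (\<forall>F. implicit_rhs b \<gamma> f u F \<and> integral_equation b \<alpha> \<gamma> c\<^sub>1 c\<^sub>2 \<phi> F u
            \<longrightarrow> (\<forall>t\<in>{1<..b}. F t = hilfer_hadamard b \<alpha> \<beta> u t))"
proof -
  have b: "1 < b" and \<alpha>: "0 < \<alpha>" "\<alpha> \<le> 1" and \<gamma>1: "\<gamma> < 1" using assms by auto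
  define w where "w = hadamard_derivative b \<gamma> u"
  define G where "G = hilfer_hadamard b \<alpha> \<beta> u"
  have *: "(1 - \<beta>) * (1 - \<alpha>) = 1 - \<gamma>" "\<beta> * (1 - \<alpha>) = \<gamma> - \<alpha>"
    using assms(6) by (simp_all add: algebra_simps)
  have G: "G = hadamard_integral (\<gamma> - \<alpha>) w"
    by (simp add: G_def w_def hilfer_hadamard_def hadamard_derivative_def *)
  have "0 \<le> \<beta> * (1 - \<alpha>)" using assms by simp
  then have \<gamma>\<alpha>: "\<alpha> \<le> \<gamma>" unfolding * by simp
  with \<alpha> have \<gamma>: "0 < \<gamma>" by simp
  have wC: "w \<in> weighted_C b \<gamma>" using assms(11) by (simp add: weighted_C_deriv_def w_def)
  have GC: "G \<in> weighted_C b \<gamma>"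
    unfolding G using \<gamma>\<alpha> \<gamma> wC by (intro weighted_C_hadamard_integral) auto
  \<comment> \<open>Used with \<open>a = \<alpha>\<close>, giving order \<gamma>, and with
    \<open>a = 1 - \<gamma> + \<alpha>\<close>, giving order 1. If \<gamma> = \<alpha> then
    \<open>G\<close> is \<open>w\<close> and no semigroup law is involved.\<close>
  have IG: "hadamard_integral a G t = hadamard_integral (a + \<gamma> - \<alpha>) w t"
    if "0 < a" "t \<in> {1<..b}" for a t
  proof (cases "\<gamma> = \<alpha>")
    case True
    then have "G = w" by (simp add: G hadamard_integral_def fun_eq_iff)
    with True show ?thesis by simp
  next
    case False
    with \<gamma>\<alpha> have "0 < \<gamma> - \<alpha>" by simp
    from hadamard_integral_semigroup[OF that(1) this \<gamma> wC that(2)] show ?thesis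
      by (simp add: G algebra_simps)
  qed
  obtain L where
    U: "\<And>t. t \<in> {1<..b} \<Longrightarrow> hadamard_integral (1 - \<gamma>) u t = L + hadamard_integral 1 w t" and
    u: "\<And>t. t \<in> {1<..b} \<Longrightarrow> u t = L * ln t powr (\<gamma> - 1) / Gamma \<gamma> + hadamard_integral \<gamma> w t"
    using weighted_C_deriv_representation[OF \<gamma> \<gamma>1 assms(11)] unfolding w_def by blast
  \<comment> \<open>\<open>K F\<close> is the coefficient of the power term in the integral
    equation; order \<open>1 - \<gamma> + \<alpha>\<close> produces its kernel exponent
    \<open>\<alpha> - \<gamma>\<close>.\<close>
  define K where "K F = \<phi> / (c\<^sub>1 + c\<^sub>2) - c\<^sub>2 / (c\<^sub>1 + c\<^sub>2) * hadamard_integral (1 - \<gamma> + \<alpha>) F b" for F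
  have KG: "K F = K G" if "\<And>t. t \<in> {1<..b} \<Longrightarrow> F t = G t" for F
    using hadamard_integral_cong[OF that, of b] b by (simp add: K_def)
  have "hadamard_integral 1 w b = hadamard_integral (1 - \<gamma> + \<alpha>) G b"
    using b \<alpha> \<gamma>1 by (subst IG) auto
  moreover have "boundary_condition b \<gamma> c\<^sub>1 c\<^sub>2 \<phi> u \<longleftrightarrow> c\<^sub>1 * L + c\<^sub>2 * (L + hadamard_integral 1 w b) = \<phi>"
    using U by (intro boundary_condition_iff[OF b \<gamma> wC])
  \<comment> \<open>The boundary condition reads (c1 + c2) L + c2 I = \<phi>, where I is the
    integral of \<open>G\<close> at b; it is solved for \<open>L\<close> since c1 + c2 is
    nonzero.\<close>
  ultimately have bc: "boundary_condition b \<gamma> c\<^sub>1 c\<^sub>2 \<phi> u \<longleftrightarrow> K G = L"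
    using assms(8) unfolding K_def diff_divide_distrib[symmetric] times_divide_eq_left
    by (auto simp: divide_eq_eq algebra_simps)
  have ie: "integral_equation b \<alpha> \<gamma> c\<^sub>1 c\<^sub>2 \<phi> F u \<longleftrightarrow>
    (\<forall>t\<in>{1<..b}. K F * ln t powr (\<gamma> - 1) / Gamma \<gamma> + hadamard_integral \<alpha> F t =
      L * ln t powr (\<gamma> - 1) / Gamma \<gamma> + hadamard_integral \<alpha> G t)" for F
  proof -
    have "\<phi> / (c\<^sub>1 + c\<^sub>2) * (ln t powr (\<gamma> - 1) / Gamma \<gamma>)
      - c\<^sub>2 / (c\<^sub>1 + c\<^sub>2) * (ln t powr (\<gamma> - 1) / Gamma \<gamma>) * (1 / Gamma (1 - \<gamma> + \<alpha>))
          * (LBINT s:{1<..b}. ln (b / s) powr (\<alpha> - \<gamma>) * F s / s)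
      + 1 / Gamma \<alpha> * (LBINT s:{1<..t}. ln (t / s) powr (\<alpha> - 1) * F s / s)
      = K F * ln t powr (\<gamma> - 1) / Gamma \<gamma> + hadamard_integral \<alpha> F t" for t
      using \<alpha> \<gamma>1 by (simp add: K_def hadamard_integral_def) (simp add: algebra_simps diff_divide_distrib)
    moreover have "u t = L * ln t powr (\<gamma> - 1) / Gamma \<gamma> + hadamard_integral \<alpha> G t"
      if "t \<in> {1<..b}" for t
      using u[OF that] IG[OF \<alpha>(1) that] by simp
    ultimately show ?thesis unfolding integral_equation_def by auto
  qed
  \<comment> \<open>The integral equation compares two representations of u, so uniqueness forces
    equal coefficients and \<open>F = G\<close> on (1,b]; \<open>K F\<close> may then be replaced by
    \<open>K G\<close>.\<close>
  have ie_iff: "integral_equation b \<alpha> \<gamma> c\<^sub>1 c\<^sub>2 \<phi> F u \<longleftrightarrow> K G = L \<and> (\<forall>t\<in>{1<..b}. F t = G t)"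
    if F: "F \<in> weighted_C b \<gamma>" for F
  proof
    assume "integral_equation b \<alpha> \<gamma> c\<^sub>1 c\<^sub>2 \<phi> F u"
    with representation_unique[OF b \<alpha> \<gamma> \<gamma>1 F GC, of "K F" L] have "K F = L" "\<forall>t\<in>{1<..b}. F t = G t"
      by (simp_all add: ie)
    with KG[of F] show "K G = L \<and> (\<forall>t\<in>{1<..b}. F t = G t)" by simp
  next
    assume "K G = L \<and> (\<forall>t\<in>{1<..b}. F t = G t)"
    moreover from this have "hadamard_integral \<alpha> F t = hadamard_integral \<alpha> G t" if "t \<in> {1<..b}" for t
      by (intro hadamard_integral_cong[OF _ that]) auto
    ultimately show "integral_equation b \<alpha> \<gamma> c\<^sub>1 c\<^sub>2 \<phi> F u"
      using KG[of F] by (simp add: ie)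
  qed
  \<comment> \<open>The witness for the forward direction is \<open>G\<close>. Conversely, any
    admissible \<open>F\<close> agrees with \<open>G\<close> on (1,b], so its implicit equation
    passes to \<open>G\<close>; the same agreement is the second conjunct.\<close>
  have "implicit_rhs b \<gamma> f u G \<longleftrightarrow> (\<forall>t\<in>{1<..b}. G t = f t (u t) (G t))"
    using GC by (simp add: implicit_rhs_def)
  moreover have "implicit_rhs b \<gamma> f u F \<Longrightarrow> F \<in> weighted_C b \<gamma>" for F
    by (simp add: implicit_rhs_def)
  moreover have "implicit_rhs b \<gamma> f u F \<longleftrightarrow> implicit_rhs b \<gamma> f u G" if "\<forall>t\<in>{1<..b}. F t = G t" for F
    using that weighted_C_cong[of b F G \<gamma>] by (simp add: implicit_rhs_def)
  ultimately show ?thesis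
    unfolding G_def[symmetric] bc using ie_iff GC by metis
qed

end
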